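(* Let $\mathcal{B}\subseteq\mathbb{N}$ be a non-empty primitive set. The Toeplitz sequence $1_{\mathcal{F}_{\mathcal{B}^*}}=\varphi_{W'}(\Delta(0))=1_{\mathcal{E}}$ is regular if and only if $m_H(\partial W')=0$.
   Context: $\mathbb{N}=\{1,2,\dots\}$. A set $\mathcal{B}\subseteq\mathbb{N}$ is primitive if there are no distinct $b,b'\in\mathcal{B}$ with $b\mid b'$. For $\mathcal{A}\subseteq\mathbb{N}$ let $\mathcal{M}_{\mathcal{A}}:=\bigcup_{a\in\mathcal{A}}a\mathbb{Z}$ and $\mathcal{F}_{\mathcal{A}}:=\mathbb{Z}\setminus\mathcal{M}_{\mathcal{A}}$. For finite $S\subseteq\mathcal{B}$ let $\mathcal{A}_S:=\{\gcd(b,\operatorname{lcm}(S)):b\in\mathcal{B}\}$ (with $\operatorname{lcm}(\emptyset)=1$), and let $\mathcal{E}:=\bigcup_{S\subseteq\mathcal{B},\,S\text{ finite}}\mathcal{F}_{\mathcal{A}_S}$. Let $\mathcal{A}_\infty$ be the set of all $n\in\mathbb{N}$ such that for every finite $S\subseteq\mathcal{B}$ there is a finite $S'$ with $S\subseteq S'\subseteq\mathcal{B}$ and $n\in\mathcal{A}_{S'}\setminus S'$. Let $\mathcal{A}_\infty^{prim}$ be the set of those $a\in\mathcal{A}_\infty$ that are not multiples of any other element of $\mathcal{A}_\infty$. Put $\mathcal{B}_0:=\mathcal{B}\setminus\mathcal{M}_{\mathcal{A}_\infty}$ and $\mathcal{B}^*:=\mathcal{B}_0\cup\mathcal{A}_\infty^{prim}$.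 Let $\Delta:\mathbb{Z}\to\prod_{b\in\mathcal{B}}\mathbb{Z}/b\mathbb{Z}$, $\Delta(n)=(n,n,\dots)$, be the canonical diagonal embedding (the product carries the product topology of discrete finite groups), let $H:=\overline{\Delta(\mathbb{Z})}$, a compact abelian group, with normalised Haar measure $m_H$. The window is $W:=\{h\in H: h_b\neq 0\ \text{for all } b\in\mathcal{B}\}$, $W':=\overline{\operatorname{int}(W)}$, and $\partial W'$ is the topological boundary of $W'$ in $H$. The function $\varphi_{W'}:H\to\{0,1\}^{\mathbb{Z}}$ is defined by $\varphi_{W'}(h)(n)=1$ if and only if $h+\Delta(n)\in W'$. A sequence $x\in\{0,1\}^{\mathbb{Z}}$ is a Toeplitz sequence if for each $n\in\mathbb{Z}$ there is $p\in\mathbb{N}$ such that $x_{n+kp}=x_n$ for all $k\in\mathbb{Z}$ (periodic sequences are included). It is regular if $\sup_{p\in\mathbb{N}}d(\operatorname{Per}_p(x))=1$, where $\operatorname{Per}_p(x):=\{n\in\mathbb{Z}:x_{n+kp}=x_n\ \forall k\in\mathbb{Z}\}$ and $d$ is asymptotic density. (That $1_{\mathcal{F}_{\mathcal{B}^*}}=\varphi_{W'}(\Delta(0))=1_{\mathcal{E}}$ and that this is a Toeplitz sequence is part of the setting.) *)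

theory Defs
  imports
    "HOL-Probability.Probability_Measure"
    "HOL-Algebra.Product_Groups"
begin

text \<open>Subsets of \<open>{1, 2, \<dots>}\<close> are sets of type \<^typ>\<open>nat set\<close> not containing \<open>0\<close>.\<close>

definition primitive_set :: "nat set \<Rightarrow> bool" where
  "primitive_set B \<longleftrightarrow> (\<forall>b\<in>B. \<forall>b'\<in>B. b dvd b' \<longrightarrow> b = b')"

definition multiples :: "nat set \<Rightarrow> int set" where
  "multiples A = (\<Union>a\<in>A. {z. int a dvd z})"

definition free_ints :: "nat set \<Rightarrow> int set" where
  "free_ints A = UNIV - multiples A"

definition gcd_set :: "nat set \<Rightarrow> nat set \<Rightarrow> nat set" where
  "gcd_set B S = {gcd b (Lcm S) | b. b \<in> B}"

definition E_set :: "nat set \<Rightarrow> int set" where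
  "E_set B = (\<Union>S\<in>{S. finite S \<and> S \<subseteq> B}. free_ints (gcd_set B S))"

definition A_inf :: "nat set \<Rightarrow> nat set" where
  "A_inf B = {n. n \<ge> 1 \<and> (\<forall>S. finite S \<and> S \<subseteq> B \<longrightarrow>
     (\<exists>S'. finite S' \<and> S \<subseteq> S' \<and> S' \<subseteq> B \<and> n \<in> gcd_set B S' - S'))}"

definition A_inf_prim :: "nat set \<Rightarrow> nat set" where
  "A_inf_prim B = {a \<in> A_inf B. \<forall>a'\<in>A_inf B. a' \<noteq> a \<longrightarrow> \<not> a' dvd a}"

definition B_zero :: "nat set \<Rightarrow> nat set" where
  "B_zero B = {b \<in> B. int b \<notin> multiples (A_inf B)}"

definition B_star :: "nat set \<Rightarrow> nat set" where
  "B_star B = B_zero B \<union> A_inf_prim B"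

text \<open>
  For \<open>b \<ge> 1\<close> the group \<open>\<int>/b\<int>\<close> is \<^term>\<open>integer_mod_group b\<close>, with carrier \<open>{0..<int b}\<close> of
  least residues; elements of the product over \<open>B\<close> are extensional functions on \<open>B\<close>.
\<close>

definition prod_grp :: "nat set \<Rightarrow> (nat \<Rightarrow> int) monoid" where
  "prod_grp B = product_group B integer_mod_group"

definition prod_top :: "nat set \<Rightarrow> (nat \<Rightarrow> int) topology" where
  "prod_top B = product_topology (\<lambda>b. discrete_topology (carrier (integer_mod_group b))) B"

definition diag :: "nat set \<Rightarrow> int \<Rightarrow> nat \<Rightarrow> int" where
  "diag B n = (\<lambda>b\<in>B. n mod int b)"

definition H_set :: "nat set \<Rightarrow> (nat \<Rightarrow> int) set" where
  "H_set B = prod_top B closure_of range (diag B)"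

definition H_grp :: "nat set \<Rightarrow> (nat \<Rightarrow> int) monoid" where
  "H_grp B = (prod_grp B)\<lparr>carrier := H_set B\<rparr>"

definition H_top :: "nat set \<Rightarrow> (nat \<Rightarrow> int) topology" where
  "H_top B = subtopology (prod_top B) (H_set B)"

text \<open>
  A translation-invariant Borel probability measure. On a second countable compact group, such as
  \<open>H\<close> (a subspace of a countable product of finite discrete groups), regularity is automatic, so
  exactly one measure has this property.
\<close>

definition normalised_haar_measure ::
    "('a, 'c) monoid_scheme \<Rightarrow> 'a topology \<Rightarrow> 'a measure \<Rightarrow> bool" where
  "normalised_haar_measure G T m \<longleftrightarrow>
     space m = topspace T \<and>
     sets m = sigma_sets (topspace T) {U. openin T U} \<and>
     prob_space m \<and>
     (\<forall>g\<in>carrier G. \<forall>A\<in>sets m. emeasure m ((\<lambda>x. g \<otimes>\<^bsub>G\<^esub> x) ` A) = emeasure m A)"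

definition window :: "nat set \<Rightarrow> (nat \<Rightarrow> int) set" where
  "window B = {h \<in> H_set B. \<forall>b\<in>B. h b \<noteq> 0}"

definition window' :: "nat set \<Rightarrow> (nat \<Rightarrow> int) set" where
  "window' B = H_top B closure_of (H_top B interior_of window B)"

definition coding :: "nat set \<Rightarrow> (nat \<Rightarrow> int) set \<Rightarrow> (nat \<Rightarrow> int) \<Rightarrow> int \<Rightarrow> nat" where
  "coding B V h n = of_bool (h \<otimes>\<^bsub>H_grp B\<^esub> diag B n \<in> V)"

definition toeplitz :: "(int \<Rightarrow> 'a) \<Rightarrow> bool" where
  "toeplitz x \<longleftrightarrow> (\<forall>n. \<exists>p::nat. p \<ge> 1 \<and> (\<forall>k::int. x (n + k * int p) = x n))"

definition Per :: "nat \<Rightarrow> (int \<Rightarrow> 'a) \<Rightarrow> int set" where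
  "Per p x = {n. \<forall>k::int. x (n + k * int p) = x n}"

text \<open>Only applied to the sets \<^term>\<open>Per p x\<close>, which are periodic, so the limit exists.\<close>

definition density :: "int set \<Rightarrow> real" where
  "density A = lim (\<lambda>N::nat. real (card (A \<inter> {- int N..int N})) / real (2 * N + 1))"

definition regular_toeplitz :: "(int \<Rightarrow> 'a) \<Rightarrow> bool" where
  "regular_toeplitz x \<longleftrightarrow> toeplitz x \<and> (SUP p\<in>{1..}. density (Per p x)) = 1"

end

theory Submission
  imports Defs
begin

text \<open>
  Everything follows from how the set \<open>E = E_set B\<close> sits in \<open>\<int>\<close>. Enlarging \<open>S\<close>
  enlarges \<open>free_ints (gcd_set B S)\<close>, so \<open>E\<close> avoids all multiples of elements of \<open>B\<close> and of
  \<open>A_inf B\<close>. Conversely, an integer \<open>n\<close> outside \<open>E\<close> that is no multiple of an element of \<open>B\<close> has,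
  for each \<open>S\<close>, a divisor in \<open>gcd_set B S - S\<close>. It has only finitely many divisors, so one of them
  occurs for cofinally many \<open>S\<close> and lies in \<open>A_inf B\<close>. Hence \<open>E\<close> is exactly the complement of
  these multiples (\<open>E_set_eq\<close>), which is \<open>free_ints (B_star B)\<close>. Moreover every \<open>n\<close> has a finite
  \<open>S \<subseteq> B\<close> such that the residue class of \<open>n\<close> modulo \<open>Lcm S\<close> lies entirely inside or entirely
  outside \<open>E\<close> (\<open>E_set_local_period\<close>). This is the Toeplitz property, with periods of the special
  form \<open>Lcm S\<close>.

  In \<open>H\<close> the cylinders given by finitely many coordinates form a basis, and the cylinder of
  \<open>diag B n\<close> over \<open>S\<close> meets the diagonal in the class of \<open>n\<close> modulo \<open>Lcm S\<close>. So \<open>diag B n\<close> is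
  interior to the window iff \<open>n \<in> E\<close>, directly from the definition of \<open>E\<close>. If \<open>n \<notin> E\<close>, the local
  period gives a cylinder around \<open>diag B n\<close> without interior points of the window, so \<open>diag B n\<close> is
  not in the closure \<open>window' B\<close> either. This identifies the coding of \<open>diag B 0\<close> with the
  indicator of \<open>E\<close>.

  For the equivalence, consider for finite \<open>S\<close> the \<open>Lcm S\<close> cylinders over \<open>S\<close>. They are translates
  of each other and partition \<open>H\<close>, so each has measure \<open>1 / Lcm S\<close>. A cylinder meets both
  \<open>window' B\<close> and its complement along the diagonal exactly if the residue class is not contained
  in \<open>Per (Lcm S)\<close>. The union of these cylinders is \<open>boundary_cover B S\<close>. It has measure
  \<open>1 - density (Per (Lcm S))\<close>, decreases as \<open>S\<close> grows, and the intersection over all \<open>S\<close> is the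
  frontier of \<open>window' B\<close>. Finally, periods that are not of the form \<open>Lcm S\<close> contribute nothing new:
  \<open>Per p\<close> is contained in some \<open>Per (Lcm S)\<close> (\<open>exists_Lcm_Per_superset\<close>). Therefore
  \<open>SUP p. density (Per p) = 1 - measure m (frontier)\<close>, which is \<open>SUP_density_Per\<close>, and the
  left side is \<open>1\<close> exactly if the frontier is a null set.
\<close>

section \<open>Periods and densities of integer sequences\<close>

lemma Per_iff: "n \<in> Per p x \<longleftrightarrow> (\<forall>m. int p dvd m - n \<longrightarrow> x m = x n)"
proof
  assume n: "n \<in> Per p x"
  show "\<forall>m. int p dvd m - n \<longrightarrow> x m = x n"
  proof (intro allI impI)
    fix m assume "int p dvd m - n"
    then obtain k where "m - n = int p * k" by (rule dvdE)
    then have "m = n + k * int p" by (simp add: algebra_simps)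
    then show "x m = x n" using n by (simp add: Per_def)
  qed
next
  assume *: "\<forall>m. int p dvd m - n \<longrightarrow> x m = x n"
  have "x (n + k * int p) = x n" for k by (rule *[rule_format]) simp
  then show "n \<in> Per p x" unfolding Per_def by blast
qed

lemma PerI: "(\<And>m. int p dvd m - n \<Longrightarrow> x m = x n) \<Longrightarrow> n \<in> Per p x"
  unfolding Per_iff by blast

lemma PerD: "n \<in> Per p x \<Longrightarrow> int p dvd m - n \<Longrightarrow> x m = x n"
  unfolding Per_iff by blast

lemma Per_indicatorD:
  assumes "n \<in> Per p (indicator A :: int \<Rightarrow> nat)" "int p dvd m - n"
  shows "m \<in> A \<longleftrightarrow> n \<in> A"
  using PerD[OF assms] by (cases "m \<in> A"; cases "n \<in> A") auto

lemma Per_cong: "n \<in> Per p x \<longleftrightarrow> m \<in> Per p x" if "int p dvd m - n"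
proof -
  have *: "n \<in> Per p x" if "m \<in> Per p x" "int p dvd m - n" for m n
  proof (rule PerI)
    fix l assume "int p dvd l - n"
    then have "int p dvd l - m"
      using dvd_diff[OF _ that(2), of "l - n"] by simp
    moreover have "int p dvd n - m" using that(2) by (subst dvd_diff_commute)
    ultimately show "x l = x n" using PerD[OF that(1)] by metis
  qed
  show ?thesis
  proof
    assume "n \<in> Per p x"
    moreover have "int p dvd n - m" using that by (subst dvd_diff_commute)
    ultimately show "m \<in> Per p x" by (rule *)
  next
    assume "m \<in> Per p x"
    then show "n \<in> Per p x" using that by (rule *)
  qed
qed

lemma Per_mono: "Per p x \<subseteq> Per q x" if "p dvd q"
  using that unfolding subset_iff Per_iff by (meson dvd_trans int_dvd_int_iff)

lemma Lcm_pos: "Lcm S \<ge> 1" if "finite S" "0 \<notin> S" for S :: "nat set"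
  using that Lcm_0_iff_nat[of S] by (cases "Lcm S") auto

lemma int_Lcm_dvd_iff: "int (Lcm S) dvd z \<longleftrightarrow> (\<forall>b\<in>S. int b dvd z)"
  by (simp add: Lcm_dvd_iff flip: dvd_nat_abs_iff)

text \<open>
  The numbers \<open>gcd p (Lcm S)\<close> are bounded by \<open>p\<close>, so some \<open>S\<close> makes this gcd \<open>g\<close> maximal, and then
  enlarging \<open>S\<close> does not change it. Two integers that agree modulo \<open>g\<close> can be joined by a
  \<open>p\<close>-step followed by a step of any length \<open>Lcm T\<close> with \<open>S \<subseteq> T\<close>. Choosing \<open>T\<close> such that \<open>Lcm T\<close>
  is a period at the target shows that the value at a \<open>p\<close>-periodic position spreads over its whole
  class modulo \<open>g\<close>, hence over its class modulo \<open>Lcm S\<close>.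
\<close>

lemma exists_Lcm_Per_superset:
  fixes B :: "nat set" and x :: "int \<Rightarrow> 'a"
  assumes local_period: "\<And>n. \<exists>S. finite S \<and> S \<subseteq> B \<and> n \<in> Per (Lcm S) x" and "p \<ge> 1"
  obtains S where "finite S" "S \<subseteq> B" "Per p x \<subseteq> Per (Lcm S) x"
proof -
  have "\<exists>S. (finite S \<and> S \<subseteq> B) \<and>
      (\<forall>T. finite T \<and> T \<subseteq> B \<longrightarrow> gcd p (Lcm T) \<le> gcd p (Lcm S))"
    using \<open>p \<ge> 1\<close> by (intro ex_has_greatest_nat[of _ "{}" _ "Suc p"])
      (auto simp: less_Suc_eq_le intro!: gcd_le1_nat)
  then obtain S where S: "finite S" "S \<subseteq> B"
    and max: "\<And>T. finite T \<Longrightarrow> T \<subseteq> B \<Longrightarrow> gcd p (Lcm T) \<le> gcd p (Lcm S)"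
    by (elim exE conjE) simp
  have "Per p x \<subseteq> Per (Lcm S) x"
  proof
    fix k assume k: "k \<in> Per p x"
    have "x m = x k" if m: "int (Lcm S) dvd m - k" for m
    proof -
      obtain T where T: "finite T" "T \<subseteq> B" "m \<in> Per (Lcm T) x" using local_period by blast
      define L where "L = Lcm (S \<union> T)"
      have "gcd p (Lcm S) dvd gcd p L"
        unfolding L_def by (intro gcd_mono Lcm_subset) auto
      moreover have "gcd p L \<le> gcd p (Lcm S)" unfolding L_def using S T by (intro max) auto
      ultimately have "gcd p L = gcd p (Lcm S)"
        using \<open>p \<ge> 1\<close> dvd_imp_le[of "gcd p (Lcm S)" "gcd p L"] by auto
      then have "int (gcd p L) dvd m - k" using m dvd_trans[OF _ m, of "int (gcd p (Lcm S))"] by simp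
      then obtain r where r: "m - k = int (gcd p L) * r" by blast
      obtain u v where uv: "u * int p + v * int L = int (gcd p L)"
        using bezout_int[of "int p" "int L"] by auto
      \<comment> \<open>The integer reached from \<open>k\<close> by a \<open>p\<close>-step and from \<open>m\<close> by an \<open>L\<close>-step, by Bezout.\<close>
      have eq: "k + (r * u) * int p = m - (r * v) * int L"
        using r uv[symmetric] by (simp add: algebra_simps)
      have "m \<in> Per L x" using T(3) Per_mono[OF Lcm_subset, of T "S \<union> T" x] unfolding L_def by blast
      then have "x (m - (r * v) * int L) = x m" by (rule PerD) simp
      moreover have "x (k + (r * u) * int p) = x k" using k by (rule PerD) simp
      ultimately show ?thesis using eq by simp
    qed
    then show "k \<in> Per (Lcm S) x" by (rule PerI)
  qed
  with S show ?thesis by (rule that)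
qed

text \<open>
  Each window of \<open>p\<close> consecutive integers contains the same number \<open>c\<close> of elements, so the number
  of elements in \<open>{-N..N}\<close> differs by at most \<open>c\<close> from \<open>(2 * N + 1) * c / p\<close>.
\<close>

lemma density_periodic:
  fixes A :: "int set" and p :: nat
  assumes "p \<ge> 1" and periodic: "\<And>m n. int p dvd m - n \<Longrightarrow> m \<in> A \<longleftrightarrow> n \<in> A"
  shows "density A = real (card (A \<inter> {0..<int p})) / real p"
proof -
  define c where "c = card (A \<inter> {0..<int p})"
  have mod_mem: "n mod int p \<in> A \<longleftrightarrow> n \<in> A" "a + (n - a) mod int p \<in> A \<longleftrightarrow> n \<in> A" for a n
    by (rule periodic, simp flip: mod_eq_dvd_iff add: mod_add_right_eq)+
  have one_period: "card (A \<inter> {a..<a + int p}) = c" for a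
  proof -
    have "bij_betw (\<lambda>n. n mod int p) (A \<inter> {a..<a + int p}) (A \<inter> {0..<int p})"
    proof (rule bij_betwI[where g = "\<lambda>n. a + (n - a) mod int p"])
      show "(\<lambda>n. n mod int p) \<in> A \<inter> {a..<a + int p} \<rightarrow> A \<inter> {0..<int p}"
        using \<open>p \<ge> 1\<close> by (auto simp: mod_mem)
      show "(\<lambda>n. a + (n - a) mod int p) \<in> A \<inter> {0..<int p} \<rightarrow> A \<inter> {a..<a + int p}"
        using \<open>p \<ge> 1\<close> by (auto simp: mod_mem)
      show "a + (n mod int p - a) mod int p = n" if "n \<in> A \<inter> {a..<a + int p}" for n
        using that by (simp add: mod_diff_left_eq)
      show "(a + (n - a) mod int p) mod int p = n" if "n \<in> A \<inter> {0..<int p}" for n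
        using that by (simp add: mod_add_right_eq)
    qed
    then show ?thesis unfolding c_def by (rule bij_betw_same_card)
  qed
  have periods: "card (A \<inter> {a..<a + int (q * p)}) = q * c" for a q
  proof (induction q)
    case (Suc q)
    have "A \<inter> {a..<a + int (Suc q * p)} = (A \<inter> {a..<a + int (q * p)}) \<union>
        (A \<inter> {a + int (q * p)..<a + int (q * p) + int p})"
    proof -
      have "a \<le> a + int (q * p)" "a + int (Suc q * p) = a + int (q * p) + int p" by simp_all
      then show ?thesis by (auto simp del: of_nat_mult)
    qed
    moreover have "card \<dots> = card (A \<inter> {a..<a + int (q * p)}) +
        card (A \<inter> {a + int (q * p)..<a + int (q * p) + int p})"
      by (intro card_Un_disjoint) auto
    ultimately show ?case using Suc one_period by simp
  qed simp
  define f where "f N = real (card (A \<inter> {- int N..int N})) / real (2 * N + 1)" for N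
  have bounds: "real c / real p - real c / real (2 * N + 1) \<le> f N \<and>
      f N \<le> real c / real p + real c / real (2 * N + 1)" for N
  proof -
    define q where "q = (2 * N + 1) div p"
    have "q * p \<le> 2 * N + 1" unfolding q_def by simp
    moreover have "2 * N + 1 < Suc q * p"
      unfolding q_def using \<open>p \<ge> 1\<close> dividend_less_div_times[of p "2 * N + 1"] by simp
    ultimately have q: "int (q * p) \<le> 2 * int N + 1" "2 * int N + 1 \<le> int (Suc q * p)"
      and "real (q * p) \<le> real (2 * N + 1)" "real (2 * N + 1) \<le> real (Suc q * p)"
      by linarith+
    then have q_real: "real q * real p \<le> real (2 * N + 1)"
      "real (2 * N + 1) \<le> (real q + 1) * real p"
      by (simp_all add: algebra_simps)
    have "A \<inter> {- int N..<- int N + int (q * p)} \<subseteq> A \<inter> {- int N..int N}" using q(1) by auto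
    then have "q * c \<le> card (A \<inter> {- int N..int N})"
      using periods[of "- int N" q] by (metis card_mono finite_Int finite_atLeastAtMost_int)
    then have lo: "real q * real c \<le> real (card (A \<inter> {- int N..int N}))"
      by (metis of_nat_le_iff of_nat_mult)
    have "A \<inter> {- int N..int N} \<subseteq> A \<inter> {- int N..<- int N + int (Suc q * p)}" using q(2) by auto
    then have "card (A \<inter> {- int N..int N}) \<le> Suc q * c"
      using periods[of "- int N" "Suc q"]
      by (metis card_mono finite_Int finite_atLeastLessThan_int)
    then have hi: "real (card (A \<inter> {- int N..int N})) \<le> (real q + 1) * real c"
      by (metis add.commute of_nat_Suc of_nat_le_iff of_nat_mult)
    have p0: "real p > 0" using \<open>p \<ge> 1\<close> by simp
    have q_le: "real q \<le> real (2 * N + 1) / real p" using q_real(1) p0 by (simp add: field_simps)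
    have q_ge: "real (2 * N + 1) / real p \<le> real q + 1" using q_real(2) p0 by (simp add: field_simps)
    define M where "M = real (2 * N + 1)"
    have M0: "M > 0" by (simp add: M_def)
    have "(M / real p - 1) * real c \<le> real (card (A \<inter> {- int N..int N}))"
      using q_ge by (intro order_trans[OF mult_right_mono lo]) (auto simp: M_def)
    then have "(M / real p - 1) * real c / M \<le> f N"
      unfolding f_def M_def[symmetric] using M0 by (intro divide_right_mono) auto
    moreover have "real (card (A \<inter> {- int N..int N})) \<le> (M / real p + 1) * real c"
      using q_le by (intro order_trans[OF hi mult_right_mono]) (auto simp: M_def)
    then have "f N \<le> (M / real p + 1) * real c / M"
      unfolding f_def M_def[symmetric] using M0 by (intro divide_right_mono) auto
    ultimately show ?thesis
      unfolding M_def[symmetric] using M0 p0 by (simp add: field_simps)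
  qed
  have vanish: "(\<lambda>N. real c / real (2 * N + 1)) \<longlonglongrightarrow> 0"
    by (rule real_tendsto_divide_at_top[OF tendsto_const])
      (rule filterlim_compose[OF filterlim_real_sequentially filterlim_subseq],
        simp add: strict_mono_def)
  have "f \<longlonglongrightarrow> real c / real p"
  proof (rule tendsto_sandwich)
    show "(\<lambda>N. real c / real p - real c / real (2 * N + 1)) \<longlonglongrightarrow> real c / real p"
      using tendsto_diff[OF tendsto_const vanish] by simp
    show "(\<lambda>N. real c / real p + real c / real (2 * N + 1)) \<longlonglongrightarrow> real c / real p"
      using tendsto_add[OF tendsto_const vanish] by simp
  qed (use bounds in auto)
  then show ?thesis unfolding density_def c_def f_def by (rule limI)
qed

lemma density_Per:
  assumes "p \<ge> 1"
  shows "density (Per p x) = real (card (Per p x \<inter> {0..<int p})) / real p"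
  using assms Per_cong by (intro density_periodic) blast+

lemma density_Per_le_1: "density (Per p x) \<le> 1" if "p \<ge> 1"
proof -
  have "card (Per p x \<inter> {0..<int p}) \<le> p"
    using card_mono[of "{0..<int p}" "Per p x \<inter> {0..<int p}"] by simp
  then show ?thesis using that by (simp add: density_Per)
qed

text \<open>
  Both sets are periodic modulo \<open>p * q\<close>, so their densities can be compared by counting in one
  common period.
\<close>

lemma density_Per_mono:
  assumes "Per p x \<subseteq> Per q x" "p \<ge> 1" "q \<ge> 1"
  shows "density (Per p x) \<le> density (Per q x)"
proof -
  have dens: "density (Per r x) = real (card (Per r x \<inter> {0..<int (p * q)})) / real (p * q)"
    if r: "r dvd p * q" for r
  proof (rule density_periodic)
    show "p * q \<ge> 1" using assms by simp
    fix m n assume mn: "int (p * q) dvd m - n"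
    have "int r dvd int (p * q)" using r by (simp only: int_dvd_int_iff)
    then have "int r dvd m - n" using mn by (rule dvd_trans)
    then show "m \<in> Per r x \<longleftrightarrow> n \<in> Per r x" using Per_cong by blast
  qed
  have "card (Per p x \<inter> {0..<int (p * q)}) \<le> card (Per q x \<inter> {0..<int (p * q)})"
    using assms(1) by (intro card_mono) auto
  then show ?thesis by (simp add: dens[of p] dens[of q] divide_right_mono)
qed

section \<open>Divisors that survive in all the sets of greatest common divisors\<close>

lemma gcd_set_pos:
  assumes "d \<in> gcd_set B S" "0 \<notin> B"
  shows "d \<ge> 1"
proof -
  obtain b where "b \<in> B" "d = gcd b (Lcm S)" using assms(1) by (auto simp: gcd_set_def)
  moreover have "b \<noteq> 0" using \<open>b \<in> B\<close> assms(2) by metis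
  ultimately have "d \<noteq> 0" by simp
  then show ?thesis by simp
qed

lemma in_free_ints_iff: "n \<in> free_ints A \<longleftrightarrow> (\<forall>a\<in>A. \<not> int a dvd n)"
  by (auto simp: free_ints_def multiples_def)

text \<open>
  A larger \<open>S\<close> replaces each \<open>gcd b (Lcm S)\<close> by a multiple of it, which has fewer multiples. So the
  union defining \<open>E_set B\<close> is directed, and failing cofinally often means failing always.
\<close>

lemma free_ints_gcd_set_mono: "free_ints (gcd_set B S) \<subseteq> free_ints (gcd_set B T)" if "S \<subseteq> T"
proof
  fix n assume n: "n \<in> free_ints (gcd_set B S)"
  have "\<not> int (gcd b (Lcm T)) dvd n" if "b \<in> B" for b
  proof -
    have "gcd b (Lcm S) dvd gcd b (Lcm T)" using \<open>S \<subseteq> T\<close> by (intro gcd_mono Lcm_subset) auto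
    moreover have "\<not> int (gcd b (Lcm S)) dvd n"
      using n that by (auto simp: in_free_ints_iff gcd_set_def)
    ultimately show ?thesis by (meson dvd_trans int_dvd_int_iff)
  qed
  then show "n \<in> free_ints (gcd_set B T)" by (auto simp: in_free_ints_iff gcd_set_def)
qed

text \<open>
  By Bezout, \<open>gcd b (Lcm S)\<close> divides \<open>n\<close> iff some integer in the residue class of \<open>n\<close> modulo \<open>Lcm S\<close>
  is a multiple of \<open>b\<close>. In this form the condition says that a whole cylinder lies in the window.
\<close>

lemma free_ints_gcd_set_iff:
  "n \<in> free_ints (gcd_set B S) \<longleftrightarrow>
    (\<forall>m. int (Lcm S) dvd m - n \<longrightarrow> (\<forall>b\<in>B. \<not> int b dvd m))"
proof -
  have "int (gcd b (Lcm S)) dvd n \<longleftrightarrow> (\<exists>m. int (Lcm S) dvd m - n \<and> int b dvd m)" for b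
  proof
    assume "int (gcd b (Lcm S)) dvd n"
    then obtain r where r: "n = int (gcd b (Lcm S)) * r" by blast
    obtain u v where uv: "u * int b + v * int (Lcm S) = int (gcd b (Lcm S))"
      using bezout_int[of "int b" "int (Lcm S)"] by auto
    have "n = r * u * int b + r * v * int (Lcm S)" using r uv[symmetric] by (simp add: algebra_simps)
    then have "int (Lcm S) dvd r * u * int b - n \<and> int b dvd r * u * int b" by simp
    then show "\<exists>m. int (Lcm S) dvd m - n \<and> int b dvd m" by blast
  next
    assume "\<exists>m. int (Lcm S) dvd m - n \<and> int b dvd m"
    then obtain m where "int (Lcm S) dvd m - n" "int b dvd m" by blast
    then have "int (gcd b (Lcm S)) dvd m - n" "int (gcd b (Lcm S)) dvd m"
      by (meson dvd_trans gcd_dvd1 gcd_dvd2 int_dvd_int_iff)+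
    then show "int (gcd b (Lcm S)) dvd n" by (simp add: dvd_diff_right_iff)
  qed
  then show ?thesis by (auto simp: in_free_ints_iff gcd_set_def)
qed

lemma E_set_iff: "n \<in> E_set B \<longleftrightarrow>
    (\<exists>S. finite S \<and> S \<subseteq> B \<and> (\<forall>m. int (Lcm S) dvd m - n \<longrightarrow> (\<forall>b\<in>B. \<not> int b dvd m)))"
  unfolding E_set_def by (auto simp: free_ints_gcd_set_iff)

lemma E_set_disjoint_A_inf:
  assumes "d \<in> A_inf B" "int d dvd n"
  shows "n \<notin> E_set B"
proof
  assume "n \<in> E_set B"
  then obtain S where S: "finite S" "S \<subseteq> B" "n \<in> free_ints (gcd_set B S)" by (auto simp: E_set_def)
  then obtain T where "S \<subseteq> T" "d \<in> gcd_set B T" using assms(1) unfolding A_inf_def by blast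
  moreover have "n \<in> free_ints (gcd_set B T)" using S free_ints_gcd_set_mono \<open>S \<subseteq> T\<close> by blast
  ultimately show False using assms(2) by (simp add: in_free_ints_iff)
qed

lemma E_set_disjoint_B: "n \<notin> E_set B" if "b \<in> B" "int b dvd n"
  using that by (auto simp: E_set_iff intro!: exI[of _ n])

text \<open>
  If \<open>n\<close> is neither in \<open>E_set B\<close> nor a multiple of an element of \<open>A_inf B\<close>, each of its finitely many
  divisors \<open>d\<close> comes with a finite set beyond which \<open>d\<close> never occurs in \<open>gcd_set B T - T\<close>. For the
  union \<open>T\<close> of these sets, the divisor that excludes \<open>n\<close> from \<open>free_ints (gcd_set B T)\<close> must
  therefore lie in \<open>T\<close>, so \<open>n\<close> is a multiple of an element of \<open>B\<close>.
\<close>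

lemma E_set_eq: "E_set B = - (multiples B \<union> multiples (A_inf B))" if "0 \<notin> B" "B \<noteq> {}"
proof -
  have "n \<in> multiples B \<union> multiples (A_inf B)" if n: "n \<notin> E_set B" for n
  proof (rule ccontr)
    assume not: "n \<notin> multiples B \<union> multiples (A_inf B)"
    define D where "D = {d. d \<ge> 1 \<and> int d dvd n}"
    \<comment> \<open>This is where \<open>B \<noteq> {}\<close> matters: \<open>0\<close> has infinitely many divisors, but is a multiple of every \<open>b \<in> B\<close>.\<close>
    have "n \<noteq> 0" using not \<open>B \<noteq> {}\<close> by (auto simp: multiples_def)
    have "finite D"
      by (rule finite_subset[OF _ finite_divisors_nat[of "nat \<bar>n\<bar>"]])
        (use \<open>n \<noteq> 0\<close> in \<open>auto simp: D_def dvd_nat_abs_iff\<close>)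
    have "\<exists>S. finite S \<and> S \<subseteq> B \<and>
        (\<forall>T. finite T \<and> S \<subseteq> T \<and> T \<subseteq> B \<longrightarrow> d \<notin> gcd_set B T - T)" if "d \<in> D" for d
    proof -
      have "d \<notin> A_inf B" using not that by (auto simp: D_def multiples_def)
      then show ?thesis using that by (auto simp: D_def A_inf_def)
    qed
    then obtain S where S: "\<And>d. d \<in> D \<Longrightarrow> finite (S d) \<and> S d \<subseteq> B \<and>
        (\<forall>T. finite T \<and> S d \<subseteq> T \<and> T \<subseteq> B \<longrightarrow> d \<notin> gcd_set B T - T)"
      by metis
    define T where "T = (\<Union>d\<in>D. S d)"
    have T: "finite T" "T \<subseteq> B" using S \<open>finite D\<close> by (auto simp: T_def)
    then have "n \<notin> free_ints (gcd_set B T)" using n by (auto simp: E_set_def)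
    then obtain d where d: "d \<in> gcd_set B T" "int d dvd n" by (auto simp: in_free_ints_iff)
    have "d \<in> D" using d gcd_set_pos \<open>0 \<notin> B\<close> by (auto simp: D_def)
    moreover have "d \<notin> T" using d T not by (auto simp: multiples_def)
    moreover have "S d \<subseteq> T" using \<open>d \<in> D\<close> by (auto simp: T_def)
    ultimately show False using S T d by blast
  qed
  moreover have "n \<notin> E_set B" if "n \<in> multiples B \<union> multiples (A_inf B)" for n
    using that E_set_disjoint_A_inf E_set_disjoint_B by (auto simp: multiples_def)
  ultimately show ?thesis by blast
qed

lemma multiples_Un: "multiples (A \<union> A') = multiples A \<union> multiples A'"
  by (simp add: multiples_def)

text \<open>
  Divisibility is well-founded on positive integers, so every element of \<open>A_inf B\<close> has a minimal
  divisor in \<open>A_inf B\<close>.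
\<close>

lemma multiples_A_inf_prim: "multiples (A_inf_prim B) = multiples (A_inf B)"
proof -
  have "\<exists>a'\<in>A_inf_prim B. a' dvd a" if "a \<in> A_inf B" for a
    using that
  proof (induction a rule: less_induct)
    case (less a)
    show ?case
    proof (cases "a \<in> A_inf_prim B")
      case False
      then obtain a' where a': "a' \<in> A_inf B" "a' \<noteq> a" "a' dvd a"
        using less.prems by (auto simp: A_inf_prim_def)
      have "a \<ge> 1" using less.prems by (simp add: A_inf_def)
      then have "a' < a" using a' by (simp add: dvd_imp_le le_neq_implies_less)
      then show ?thesis using less.IH a' by (meson dvd_trans)
    qed (auto intro: bexI[of _ a])
  qed
  then show ?thesis
  proof (intro equalityI subsetI)
    assume *: "\<And>a. a \<in> A_inf B \<Longrightarrow> \<exists>a'\<in>A_inf_prim B. a' dvd a"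
    fix n assume "n \<in> multiples (A_inf B)"
    then obtain a where "a \<in> A_inf B" "int a dvd n" by (auto simp: multiples_def)
    with * obtain a' where "a' \<in> A_inf_prim B" "a' dvd a" by blast
    moreover from this have "int a' dvd n"
      using \<open>int a dvd n\<close> dvd_trans[of "int a'" "int a"] by simp
    ultimately show "n \<in> multiples (A_inf_prim B)" by (auto simp: multiples_def)
  qed (auto simp: multiples_def A_inf_prim_def)
qed

lemma free_ints_B_star: "free_ints (B_star B) = E_set B" if "0 \<notin> B" "B \<noteq> {}"
proof -
  have "multiples (B_star B) = multiples (B_zero B) \<union> multiples (A_inf B)"
    by (simp add: B_star_def multiples_Un multiples_A_inf_prim)
  also have "\<dots> = multiples B \<union> multiples (A_inf B)"
  proof (intro equalityI subsetI)
    fix n assume n: "n \<in> multiples B \<union> multiples (A_inf B)"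
    show "n \<in> multiples (B_zero B) \<union> multiples (A_inf B)"
    proof (rule ccontr)
      assume not: "n \<notin> multiples (B_zero B) \<union> multiples (A_inf B)"
      then obtain b where b: "b \<in> B" "int b dvd n" using n by (auto simp: multiples_def)
      then obtain a where "a \<in> A_inf B" "int a dvd int b"
        using not by (auto simp: B_zero_def multiples_def)
      moreover from this have "int a dvd n" using b dvd_trans[of "int a" "int b"] by simp
      ultimately show False using not by (auto simp: multiples_def)
    qed
  qed (auto simp: multiples_def B_zero_def)
  finally show ?thesis using E_set_eq[OF that] by (auto simp: free_ints_def)
qed

text \<open>
  Membership in \<open>E_set B\<close> is witnessed by some \<open>S\<close> itself, and non-membership by a divisor \<open>b \<in> B\<close>
  or \<open>d \<in> A_inf B\<close>. The latter divides some \<open>Lcm S\<close> because it belongs to \<open>gcd_set B S\<close>, so in every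
  case the witness is shared by a whole residue class modulo some \<open>Lcm S\<close>.
\<close>

lemma E_set_local_period:
  assumes "0 \<notin> B" "B \<noteq> {}"
  shows "\<exists>S. finite S \<and> S \<subseteq> B \<and> n \<in> Per (Lcm S) (indicator (E_set B) :: int \<Rightarrow> nat)"
proof -
  have *: ?thesis if S: "finite S" "S \<subseteq> B"
    and "\<And>m. int (Lcm S) dvd m - n \<Longrightarrow> m \<in> E_set B \<longleftrightarrow> n \<in> E_set B" for S
  proof -
    have "n \<in> Per (Lcm S) (indicator (E_set B) :: int \<Rightarrow> nat)"
    proof (rule PerI)
      fix m assume "int (Lcm S) dvd m - n"
      then have "m \<in> E_set B \<longleftrightarrow> n \<in> E_set B" by (rule that(3))
      then show "indicator (E_set B) m = (indicator (E_set B) n :: nat)" by (simp add: indicator_def)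
    qed
    with S show ?thesis by blast
  qed
  consider "n \<in> E_set B" | b where "b \<in> B" "int b dvd n" | d where "d \<in> A_inf B" "int d dvd n"
    using E_set_eq[OF assms] by (auto simp: multiples_def)
  then show ?thesis
  proof cases
    case 1
    then obtain S where S: "finite S" "S \<subseteq> B"
      "\<And>m. int (Lcm S) dvd m - n \<Longrightarrow> \<forall>b\<in>B. \<not> int b dvd m"
      by (auto simp: E_set_iff)
    have "m \<in> E_set B" if "int (Lcm S) dvd m - n" for m
      unfolding E_set_iff
    proof (intro exI conjI allI impI)
      fix l assume "int (Lcm S) dvd l - m"
      then have "int (Lcm S) dvd l - n" using dvd_add[OF _ that, of "l - m"] by simp
      then show "\<forall>b\<in>B. \<not> int b dvd l" by (rule S)
    qed (use S in auto)
    then show ?thesis using 1 by (intro *[OF S(1,2)]) simp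
  next
    case 2
    have "m \<notin> E_set B" if "int (Lcm {b}) dvd m - n" for m
    proof -
      have "int b dvd m" using that 2(2) by (simp add: int_Lcm_dvd_iff dvd_diff_left_iff)
      then show ?thesis using 2 E_set_disjoint_B by blast
    qed
    moreover have "n \<notin> E_set B" using 2 E_set_disjoint_B by blast
    ultimately show ?thesis using 2 by (intro *[of "{b}"]) auto
  next
    case 3
    have "finite {} \<and> {} \<subseteq> B" by simp
    then obtain S where S: "finite S" "S \<subseteq> B" "d \<in> gcd_set B S"
      using 3(1) unfolding A_inf_def by blast
    have "m \<notin> E_set B" if "int (Lcm S) dvd m - n" for m
    proof -
      have "d dvd Lcm S" using S(3) by (auto simp: gcd_set_def)
      then have "int d dvd m - n" using that by (meson dvd_trans int_dvd_int_iff)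
      then have "int d dvd m" using 3(2) by (simp add: dvd_diff_left_iff)
      then show ?thesis using 3 E_set_disjoint_A_inf by blast
    qed
    moreover have "n \<notin> E_set B" using 3 E_set_disjoint_A_inf by blast
    ultimately show ?thesis by (intro *[OF S(1,2)]) simp
  qed
qed

section \<open>The closure of the diagonal and its cylinders\<close>

lemma openin_product_discrete_iff:
  "openin (product_topology (\<lambda>i. discrete_topology (C i)) I) U \<longleftrightarrow>
    U \<subseteq> Pi\<^sub>E I C \<and>
    (\<forall>h\<in>U. \<exists>S. finite S \<and> S \<subseteq> I \<and> {g \<in> Pi\<^sub>E I C. \<forall>i\<in>S. g i = h i} \<subseteq> U)"
  (is "?open \<longleftrightarrow> ?rhs")
proof
  assume U: ?open
  then have "U \<subseteq> Pi\<^sub>E I C" using openin_subset by fastforce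
  moreover have "\<exists>S. finite S \<and> S \<subseteq> I \<and> {g \<in> Pi\<^sub>E I C. \<forall>i\<in>S. g i = h i} \<subseteq> U" if "h \<in> U" for h
  proof -
    obtain V where V: "finite {i \<in> I. V i \<noteq> C i}" "h \<in> Pi\<^sub>E I V" "Pi\<^sub>E I V \<subseteq> U"
      using U \<open>h \<in> U\<close> unfolding openin_product_topology_alt by auto
    define S where "S = {i \<in> I. V i \<noteq> C i}"
    have "{g \<in> Pi\<^sub>E I C. \<forall>i\<in>S. g i = h i} \<subseteq> Pi\<^sub>E I V"
    proof
      fix g assume g: "g \<in> {g \<in> Pi\<^sub>E I C. \<forall>i\<in>S. g i = h i}"
      have "g i \<in> V i" if "i \<in> I" for i
        using g V(2) that by (cases "i \<in> S") (auto simp: S_def PiE_iff)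
      then show "g \<in> Pi\<^sub>E I V" using g by (simp add: PiE_iff)
    qed
    then have "{g \<in> Pi\<^sub>E I C. \<forall>i\<in>S. g i = h i} \<subseteq> U" using V(3) by (rule subset_trans)
    moreover have "finite S" "S \<subseteq> I" using V(1) by (auto simp: S_def)
    ultimately show ?thesis by (intro exI[of _ S] conjI)
  qed
  ultimately show ?rhs by (intro conjI ballI)
next
  assume ?rhs
  define P where "P = Pi\<^sub>E I C"
  have rhs: "U \<subseteq> P" "\<forall>h\<in>U. \<exists>S. finite S \<and> S \<subseteq> I \<and> {g \<in> P. \<forall>i\<in>S. g i = h i} \<subseteq> U"
    using \<open>?rhs\<close> unfolding P_def by simp_all
  show ?open
    unfolding openin_product_topology_alt
  proof
    fix h assume "h \<in> U"
    then obtain S where S: "finite S" "S \<subseteq> I" "{g \<in> P. \<forall>i\<in>S. g i = h i} \<subseteq> U"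
      using bspec[OF rhs(2)] by meson
    have h: "h \<in> Pi\<^sub>E I C" using rhs(1) \<open>h \<in> U\<close> unfolding P_def by (rule subsetD)
    define V where "V i = (if i \<in> S then {h i} else C i)" for i
    have "{i \<in> I. V i \<noteq> topspace (discrete_topology (C i))} \<subseteq> S" by (auto simp: V_def)
    then have "finite {i \<in> I. V i \<noteq> topspace (discrete_topology (C i))}"
      using S(1) by (rule finite_subset)
    moreover have "\<forall>i\<in>I. openin (discrete_topology (C i)) (V i)"
      using h by (auto simp: V_def PiE_iff)
    moreover have "h \<in> Pi\<^sub>E I V" using h by (auto simp: V_def PiE_iff)
    moreover have "Pi\<^sub>E I V \<subseteq> U"
    proof
      fix g assume g: "g \<in> Pi\<^sub>E I V"
      have "g i \<in> C i" if "i \<in> I" for i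
        using PiE_mem[OF g that] PiE_mem[OF h that] by (auto simp: V_def split: if_splits)
      then have "g \<in> P" using g by (simp add: P_def PiE_iff)
      moreover have "g i = h i" if "i \<in> S" for i
        using PiE_mem[OF g, of i] that S(2) by (auto simp: V_def)
      ultimately show "g \<in> U" using S(3) by blast
    qed
    ultimately show "\<exists>V. finite {i \<in> I. V i \<noteq> topspace (discrete_topology (C i))} \<and>
        (\<forall>i\<in>I. openin (discrete_topology (C i)) (V i)) \<and> h \<in> Pi\<^sub>E I V \<and> Pi\<^sub>E I V \<subseteq> U"
      by (intro exI[of _ V] conjI)
  qed
qed

lemma diag_apply: "diag B n b = n mod int b" if "b \<in> B"
  using that by (simp add: diag_def)

definition residue_families :: "nat set \<Rightarrow> (nat \<Rightarrow> int) set" where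
  "residue_families B = Pi\<^sub>E B (\<lambda>b. {0..<int b})"

definition cylinder :: "nat set \<Rightarrow> nat set \<Rightarrow> (nat \<Rightarrow> int) \<Rightarrow> (nat \<Rightarrow> int) set" where
  "cylinder B S h = {g \<in> H_set B. \<forall>b\<in>S. g b = h b}"

lemma in_cylinder: "g \<in> cylinder B S h \<longleftrightarrow> g \<in> H_set B \<and> (\<forall>b\<in>S. g b = h b)"
  by (simp add: cylinder_def)

lemma cylinder_eq: "cylinder B S g = cylinder B S h" if "\<forall>b\<in>S. g b = h b"
  using that by (auto simp: cylinder_def)

lemma cylinder_mono: "cylinder B T h \<subseteq> cylinder B S h" if "S \<subseteq> T"
  using that by (auto simp: cylinder_def)

context
  fixes B :: "nat set"
  assumes zero: "0 \<notin> B"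
begin

lemma base_pos: "b > 0" if "b \<in> B"
  using zero that by (metis neq0_conv)

lemma carrier_residues: "Pi\<^sub>E B (\<lambda>b. carrier (integer_mod_group b)) = residue_families B"
  unfolding residue_families_def by (intro PiE_cong) (auto simp: carrier_integer_mod_group dest: base_pos)

lemma openin_prod_top_iff:
  "openin (prod_top B) U \<longleftrightarrow> U \<subseteq> residue_families B \<and>
    (\<forall>h\<in>U. \<exists>S. finite S \<and> S \<subseteq> B \<and> {g \<in> residue_families B. \<forall>b\<in>S. g b = h b} \<subseteq> U)"
  unfolding prod_top_def openin_product_discrete_iff carrier_residues ..

lemma topspace_prod_top: "topspace (prod_top B) = residue_families B"
  by (simp add: prod_top_def carrier_residues)

lemma H_set_iff:
  "h \<in> H_set B \<longleftrightarrow> h \<in> residue_families B \<and>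
    (\<forall>S. finite S \<and> S \<subseteq> B \<longrightarrow> (\<exists>n. \<forall>b\<in>S. h b = n mod int b))"
proof (intro iffI conjI allI impI)
  assume h: "h \<in> H_set B"
  then show P: "h \<in> residue_families B"
    by (simp add: H_set_def in_closure_of topspace_prod_top)
  fix S assume S: "finite S \<and> S \<subseteq> B"
  define T where "T = {g \<in> residue_families B. \<forall>b\<in>S. g b = h b}"
  have "openin (prod_top B) T"
    unfolding openin_prod_top_iff using S by (auto simp: T_def intro!: exI[of _ S])
  moreover have "h \<in> T" using P by (simp add: T_def)
  ultimately obtain n where "diag B n \<in> T"
    using h unfolding H_set_def in_closure_of by blast
  then have "h b = n mod int b" if "b \<in> S" for b
    using S that diag_apply[of b B n] by (auto simp: T_def)
  then show "\<exists>n. \<forall>b\<in>S. h b = n mod int b" by blast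
next
  assume h: "h \<in> residue_families B \<and>
    (\<forall>S. finite S \<and> S \<subseteq> B \<longrightarrow> (\<exists>n. \<forall>b\<in>S. h b = n mod int b))"
  have "\<exists>g. g \<in> range (diag B) \<and> g \<in> T" if T: "h \<in> T" "openin (prod_top B) T" for T
  proof -
    obtain S where S: "finite S" "S \<subseteq> B" "{g \<in> residue_families B. \<forall>b\<in>S. g b = h b} \<subseteq> T"
      using T unfolding openin_prod_top_iff by meson
    obtain n where n: "\<forall>b\<in>S. h b = n mod int b" using h S(1,2) by blast
    have "diag B n \<in> residue_families B"
      by (auto simp: residue_families_def diag_def PiE_iff base_pos)
    moreover have "diag B n b = h b" if "b \<in> S" for b
      using n S(2) that by (auto simp: diag_apply)
    ultimately show ?thesis using S(3) by blast
  qed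
  then show "h \<in> H_set B"
    using h by (simp add: H_set_def in_closure_of topspace_prod_top)
qed

lemma H_set_residue: "0 \<le> h b" "h b < int b" if "h \<in> H_set B" "b \<in> B"
  using that by (auto simp: H_set_iff residue_families_def PiE_iff)

lemma diag_in_H_set: "diag B n \<in> H_set B"
proof -
  have "diag B n \<in> residue_families B"
    by (auto simp: residue_families_def diag_def PiE_iff base_pos)
  moreover have "\<forall>b\<in>S. diag B n b = n mod int b" if "S \<subseteq> B" for S
    using that by (auto simp: diag_apply)
  ultimately show ?thesis unfolding H_set_iff by blast
qed

lemma topspace_H_top: "topspace (H_top B) = H_set B"
  by (auto simp: H_top_def H_set_iff topspace_prod_top)

lemma openin_H_top_iff:
  "openin (H_top B) U \<longleftrightarrow> U \<subseteq> H_set B \<and>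
    (\<forall>h\<in>U. \<exists>S. finite S \<and> S \<subseteq> B \<and> cylinder B S h \<subseteq> U)"
proof (intro iffI conjI ballI)
  assume U: "openin (H_top B) U"
  then show "U \<subseteq> H_set B" using openin_subset[OF U] by (simp add: topspace_H_top)
  fix h assume "h \<in> U"
  obtain T where T: "openin (prod_top B) T" "U = T \<inter> H_set B"
    using U by (auto simp: H_top_def openin_subtopology)
  have "h \<in> T" using T(2) \<open>h \<in> U\<close> by blast
  obtain S where "finite S" "S \<subseteq> B" "{g \<in> residue_families B. \<forall>b\<in>S. g b = h b} \<subseteq> T"
    using T(1) \<open>h \<in> T\<close> unfolding openin_prod_top_iff by meson
  then show "\<exists>S. finite S \<and> S \<subseteq> B \<and> cylinder B S h \<subseteq> U"
    using T(2) by (intro exI[of _ S]) (auto simp: in_cylinder H_set_iff)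
next
  assume U: "U \<subseteq> H_set B \<and> (\<forall>h\<in>U. \<exists>S. finite S \<and> S \<subseteq> B \<and> cylinder B S h \<subseteq> U)"
  define T where "T = {g \<in> residue_families B.
    \<exists>S h. finite S \<and> S \<subseteq> B \<and> h \<in> U \<and> cylinder B S h \<subseteq> U \<and> (\<forall>b\<in>S. g b = h b)}"
  have "openin (prod_top B) T"
    unfolding openin_prod_top_iff
  proof (intro conjI ballI)
    fix g assume "g \<in> T"
    then obtain S h where S: "finite S" "S \<subseteq> B" "h \<in> U" "cylinder B S h \<subseteq> U" "\<forall>b\<in>S. g b = h b"
      by (auto simp: T_def)
    have "g' \<in> T" if "g' \<in> residue_families B" "\<forall>b\<in>S. g' b = g b" for g'
    proof -
      have "\<forall>b\<in>S. g' b = h b" using that S(5) by simp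
      then show ?thesis using that S unfolding T_def by blast
    qed
    then show "\<exists>S. finite S \<and> S \<subseteq> B \<and> {g' \<in> residue_families B. \<forall>b\<in>S. g' b = g b} \<subseteq> T"
      using S by blast
  qed (auto simp: T_def)
  moreover have "U = T \<inter> H_set B"
  proof (intro equalityI subsetI)
    fix g assume "g \<in> U"
    then obtain S where "finite S" "S \<subseteq> B" "cylinder B S g \<subseteq> U" using U by blast
    moreover have "g \<in> H_set B" using U \<open>g \<in> U\<close> by blast
    moreover have "g \<in> residue_families B" using \<open>g \<in> H_set B\<close> by (simp add: H_set_iff)
    ultimately show "g \<in> T \<inter> H_set B" using \<open>g \<in> U\<close> unfolding T_def by blast
  next
    fix g assume "g \<in> T \<inter> H_set B"
    then show "g \<in> U" by (auto simp: T_def in_cylinder subset_iff)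
  qed
  ultimately show "openin (H_top B) U" by (auto simp: H_top_def openin_subtopology)
qed

lemma openin_cylinder: "openin (H_top B) (cylinder B S h)" if "finite S" "S \<subseteq> B"
  unfolding openin_H_top_iff
proof (intro conjI ballI)
  fix g assume "g \<in> cylinder B S h"
  then have "cylinder B S g = cylinder B S h" by (intro cylinder_eq) (simp add: in_cylinder)
  then show "\<exists>S'. finite S' \<and> S' \<subseteq> B \<and> cylinder B S' g \<subseteq> cylinder B S h" using that by blast
qed (auto simp: in_cylinder)

lemma closure_of_H_top_iff:
  "h \<in> H_top B closure_of A \<longleftrightarrow> h \<in> H_set B \<and>
    (\<forall>S. finite S \<and> S \<subseteq> B \<longrightarrow> A \<inter> cylinder B S h \<noteq> {})"
proof (intro iffI conjI allI impI)
  assume h: "h \<in> H_top B closure_of A"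
  then show "h \<in> H_set B" by (simp add: in_closure_of topspace_H_top)
  then have "h \<in> cylinder B S h" for S by (simp add: in_cylinder)
  then show "A \<inter> cylinder B S h \<noteq> {}" if "finite S \<and> S \<subseteq> B" for S
    using h that openin_cylinder[of S h] unfolding in_closure_of by blast
next
  assume h: "h \<in> H_set B \<and> (\<forall>S. finite S \<and> S \<subseteq> B \<longrightarrow> A \<inter> cylinder B S h \<noteq> {})"
  show "h \<in> H_top B closure_of A"
    unfolding in_closure_of topspace_H_top
  proof (intro conjI allI impI)
    fix T assume T: "h \<in> T \<and> openin (H_top B) T"
    then obtain S where "finite S" "S \<subseteq> B" "cylinder B S h \<subseteq> T"
      unfolding openin_H_top_iff by meson
    then show "\<exists>y. y \<in> A \<and> y \<in> T" using h by blast
  qed (use h in blast)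
qed

lemma interior_of_H_top_iff:
  "h \<in> H_top B interior_of A \<longleftrightarrow> h \<in> H_set B \<and>
    (\<exists>S. finite S \<and> S \<subseteq> B \<and> cylinder B S h \<subseteq> A)"
proof
  assume "h \<in> H_top B interior_of A"
  then obtain T where T: "openin (H_top B) T" "h \<in> T" "T \<subseteq> A" by (auto simp: interior_of_def)
  then obtain S where S: "finite S" "S \<subseteq> B" "cylinder B S h \<subseteq> T"
    unfolding openin_H_top_iff by meson
  have "h \<in> H_set B" using openin_subset[OF T(1)] T(2) by (auto simp: topspace_H_top)
  moreover have "cylinder B S h \<subseteq> A" using S(3) T(3) by (rule subset_trans)
  ultimately show "h \<in> H_set B \<and> (\<exists>S. finite S \<and> S \<subseteq> B \<and> cylinder B S h \<subseteq> A)"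
    using S by auto
next
  assume "h \<in> H_set B \<and> (\<exists>S. finite S \<and> S \<subseteq> B \<and> cylinder B S h \<subseteq> A)"
  then obtain S where S: "finite S" "S \<subseteq> B" "cylinder B S h \<subseteq> A" "h \<in> cylinder B S h"
    by (auto simp: in_cylinder)
  then show "h \<in> H_top B interior_of A"
    using openin_cylinder[of S h] unfolding interior_of_def by blast
qed

lemma diag_dense:
  assumes "h \<in> H_set B" "finite S" "S \<subseteq> B"
  obtains n where "diag B n \<in> cylinder B S h"
proof -
  obtain n where "\<forall>b\<in>S. h b = n mod int b" using assms unfolding H_set_iff by blast
  then have "diag B n \<in> cylinder B S h"
    using assms(3) by (auto simp: in_cylinder diag_in_H_set diag_apply)
  then show ?thesis by (rule that)
qed

text \<open>
  The link between topology and arithmetic: cylinders cut the diagonal into residue classes.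
\<close>

lemma diag_in_cylinder_diag:
  "diag B m \<in> cylinder B S (diag B n) \<longleftrightarrow> int (Lcm S) dvd m - n" if "S \<subseteq> B"
proof -
  have "diag B m b = diag B n b \<longleftrightarrow> int b dvd m - n" if "b \<in> S" for b
    using that \<open>S \<subseteq> B\<close> by (subst (1 2) diag_apply) (auto simp: mod_eq_dvd_iff)
  then show ?thesis by (simp add: in_cylinder diag_in_H_set int_Lcm_dvd_iff)
qed

text \<open>
  Density of the diagonal, applied inside a given cylinder. It transfers statements about interior
  points of the window near \<open>g\<close> to statements about integers.
\<close>

lemma open_meets_diag:
  assumes "openin (H_top B) U" "g \<in> U" "finite S" "S \<subseteq> B"
  obtains m where "diag B m \<in> U" "diag B m \<in> cylinder B S g"
proof -
  obtain T where T: "finite T" "T \<subseteq> B" "cylinder B T g \<subseteq> U"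
    using assms(1,2) unfolding openin_H_top_iff by meson
  have "g \<in> H_set B" using openin_subset[OF assms(1)] assms(2) by (auto simp: topspace_H_top)
  then obtain m where "diag B m \<in> cylinder B (S \<union> T) g"
    using diag_dense[of g "S \<union> T"] assms T by auto
  then have "diag B m \<in> U" "diag B m \<in> cylinder B S g"
    using T(3) cylinder_mono[of T "S \<union> T" B g] cylinder_mono[of S "S \<union> T" B g] by blast+
  then show ?thesis by (rule that)
qed

text \<open>
  Each condition \<open>g b = 0\<close> depends on one coordinate only, so if it holds at some point of a
  cylinder then it holds at a diagonal point of that cylinder. Hence the cylinder of \<open>diag B n\<close> over
  \<open>S\<close> lies in the window iff no integer in the class of \<open>n\<close> modulo \<open>Lcm S\<close> is a multiple of an
  element of \<open>B\<close>, and by \<open>E_set_iff\<close> such an \<open>S\<close> exists iff \<open>n \<in> E_set B\<close>.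
\<close>

lemma diag_in_interior_window_iff:
  "diag B n \<in> H_top B interior_of window B \<longleftrightarrow> n \<in> E_set B"
proof -
  have *: "cylinder B S (diag B n) \<subseteq> window B \<longleftrightarrow>
      (\<forall>m. int (Lcm S) dvd m - n \<longrightarrow> (\<forall>b\<in>B. \<not> int b dvd m))"
    if S: "finite S" "S \<subseteq> B" for S
  proof (intro iffI allI impI ballI subsetI)
    fix m b assume "cylinder B S (diag B n) \<subseteq> window B" "int (Lcm S) dvd m - n" "b \<in> B"
    then have "diag B m \<in> window B" using diag_in_cylinder_diag[OF S(2)] by blast
    then have "diag B m b \<noteq> 0" using \<open>b \<in> B\<close> by (simp add: window_def)
    then show "\<not> int b dvd m" using \<open>b \<in> B\<close> by (simp add: diag_apply dvd_eq_mod_eq_0)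
  next
    fix g assume free: "\<forall>m. int (Lcm S) dvd m - n \<longrightarrow> (\<forall>b\<in>B. \<not> int b dvd m)"
      and g: "g \<in> cylinder B S (diag B n)"
    have "g b \<noteq> 0" if "b \<in> B" for b
    proof -
      obtain m where m: "diag B m \<in> cylinder B (insert b S) g"
        using diag_dense[of g "insert b S"] g S \<open>b \<in> B\<close> by (auto simp: in_cylinder)
      then have "diag B m \<in> cylinder B S (diag B n)" using g by (simp add: in_cylinder)
      then have "\<not> int b dvd m" using free that diag_in_cylinder_diag[OF S(2)] by blast
      then show ?thesis
        using m that by (simp add: in_cylinder diag_apply dvd_eq_mod_eq_0)
    qed
    then show "g \<in> window B" using g by (simp add: window_def in_cylinder)
  qed
  then show ?thesis
    by (simp add: interior_of_H_top_iff E_set_iff diag_in_H_set * cong: conj_cong)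
qed

end

section \<open>The window on the diagonal\<close>

text \<open>
  Interior points of the window arbitrarily close to \<open>diag B n\<close> yield diagonal ones, that is,
  elements of \<open>E_set B\<close> in each class of \<open>n\<close> modulo \<open>Lcm S\<close>. For the local period of \<open>n\<close> this
  forces \<open>n \<in> E_set B\<close>.
\<close>

lemma diag_in_window'_iff:
  assumes zero: "0 \<notin> B" and "B \<noteq> {}"
  shows "diag B n \<in> window' B \<longleftrightarrow> n \<in> E_set B"
proof
  assume n: "diag B n \<in> window' B"
  obtain S where S: "finite S" "S \<subseteq> B" "n \<in> Per (Lcm S) (indicator (E_set B) :: int \<Rightarrow> nat)"
    using E_set_local_period[OF assms] by blast
  obtain g where g: "g \<in> H_top B interior_of window B" "g \<in> cylinder B S (diag B n)"
    using n S(1,2) unfolding window'_def closure_of_H_top_iff[OF zero] by blast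
  obtain m where m: "diag B m \<in> H_top B interior_of window B" "diag B m \<in> cylinder B S g"
    using open_meets_diag[OF zero openin_interior_of g(1) S(1,2)] by blast
  have "cylinder B S g = cylinder B S (diag B n)" using g(2) by (intro cylinder_eq) (simp add: in_cylinder)
  then have "int (Lcm S) dvd m - n" using m(2) diag_in_cylinder_diag[OF zero S(2)] by simp
  then have "m \<in> E_set B \<longleftrightarrow> n \<in> E_set B" using S(3) by (intro Per_indicatorD)
  moreover have "m \<in> E_set B" using m(1) diag_in_interior_window_iff[OF zero] by simp
  ultimately show "n \<in> E_set B" by simp
next
  assume "n \<in> E_set B"
  then have "diag B n \<in> H_top B interior_of window B" using diag_in_interior_window_iff[OF zero] by simp
  then show "diag B n \<in> window' B"
    unfolding window'_def using closure_of_subset interior_of_subset_topspace by (metis subsetD)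
qed

text \<open>
  The union of the cylinders over \<open>S\<close> that contain diagonal points both with and without
  index in \<open>E_set B\<close>: these are the residue classes outside \<open>Per (Lcm S)\<close>. One representative
  of each class suffices, which makes the union finite and disjoint.
\<close>

definition boundary_cover :: "nat set \<Rightarrow> nat set \<Rightarrow> (nat \<Rightarrow> int) set" where
  "boundary_cover B S = (\<Union>k\<in>{0..<int (Lcm S)} - Per (Lcm S) (indicator (E_set B) :: int \<Rightarrow> nat).
     cylinder B S (diag B k))"

lemma in_boundary_cover_diag:
  assumes zero: "0 \<notin> B" and S: "finite S" "S \<subseteq> B" and h: "h \<in> H_set B"
    and k: "diag B k \<in> cylinder B S h"
  shows "h \<in> boundary_cover B S \<longleftrightarrow> k \<notin> Per (Lcm S) (indicator (E_set B) :: int \<Rightarrow> nat)"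
proof -
  let ?x = "indicator (E_set B) :: int \<Rightarrow> nat"
  have hk: "h \<in> cylinder B S (diag B l) \<longleftrightarrow> int (Lcm S) dvd k - l" for l
  proof -
    have "h \<in> cylinder B S (diag B l) \<longleftrightarrow> diag B k \<in> cylinder B S (diag B l)"
      using h k by (simp add: in_cylinder)
    then show ?thesis by (simp add: diag_in_cylinder_diag[OF zero S(2)])
  qed
  show ?thesis
  proof
    assume "h \<in> boundary_cover B S"
    then obtain l where "l \<notin> Per (Lcm S) ?x" "h \<in> cylinder B S (diag B l)"
      by (auto simp: boundary_cover_def)
    then show "k \<notin> Per (Lcm S) ?x" using Per_cong hk by blast
  next
    assume "k \<notin> Per (Lcm S) ?x"
    define l where "l = k mod int (Lcm S)"
    have "int (Lcm S) dvd k - l" by (simp add: l_def)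
    moreover from this have "l \<notin> Per (Lcm S) ?x" using \<open>k \<notin> Per (Lcm S) ?x\<close> Per_cong by blast
    moreover have "Lcm S \<ge> 1" using S zero by (intro Lcm_pos) auto
    then have "l \<in> {0..<int (Lcm S)}" by (simp add: l_def)
    ultimately show "h \<in> boundary_cover B S" using hk unfolding boundary_cover_def by blast
  qed
qed

lemma boundary_cover_antimono:
  assumes zero: "0 \<notin> B" and T: "finite T" "T \<subseteq> B" and "S \<subseteq> T"
  shows "boundary_cover B T \<subseteq> boundary_cover B S"
proof
  let ?x = "indicator (E_set B) :: int \<Rightarrow> nat"
  fix h assume h: "h \<in> boundary_cover B T"
  then have "h \<in> H_set B" by (auto simp: boundary_cover_def in_cylinder)
  then obtain k where k: "diag B k \<in> cylinder B T h" using diag_dense[OF zero _ T] by blast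
  then have "k \<notin> Per (Lcm T) ?x" using h in_boundary_cover_diag[OF zero T \<open>h \<in> H_set B\<close>] by simp
  then have "k \<notin> Per (Lcm S) ?x" using Per_mono[OF Lcm_subset[OF \<open>S \<subseteq> T\<close>]] by blast
  moreover have "diag B k \<in> cylinder B S h" using k cylinder_mono[OF \<open>S \<subseteq> T\<close>] by blast
  moreover have "finite S" "S \<subseteq> B" using T \<open>S \<subseteq> T\<close> finite_subset by auto
  ultimately show "h \<in> boundary_cover B S"
    using in_boundary_cover_diag[OF zero _ _ \<open>h \<in> H_set B\<close>] by blast
qed

text \<open>
  A cylinder whose residue class lies in \<open>E_set B\<close> is contained in \<open>window' B\<close>, since each of its
  points is a limit of diagonal points interior to the window. A cylinder whose residue class avoids
  \<open>E_set B\<close> contains no interior point of the window, because near such a point there would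
  be a diagonal one. Neither kind meets the frontier.
\<close>

lemma frontier_subset_boundary_cover:
  assumes zero: "0 \<notin> B" and "B \<noteq> {}" and S: "finite S" "S \<subseteq> B"
  shows "H_top B frontier_of window' B \<subseteq> boundary_cover B S"
proof
  let ?x = "indicator (E_set B) :: int \<Rightarrow> nat"
  fix h assume h: "h \<in> H_top B frontier_of window' B"
  have cl: "h \<in> H_top B closure_of window' B" and not_int: "h \<notin> H_top B interior_of window' B"
    using h by (auto simp: frontier_of_def)
  have H: "h \<in> H_set B" using cl by (simp add: closure_of_H_top_iff[OF zero])
  obtain k where k: "diag B k \<in> cylinder B S h" using diag_dense[OF zero H S] by blast
  have diag_cyl: "diag B m \<in> cylinder B S h \<longleftrightarrow> int (Lcm S) dvd m - k" for m
  proof -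
    have "cylinder B S h = cylinder B S (diag B k)"
      using k by (intro cylinder_eq) (simp add: in_cylinder)
    then show ?thesis by (simp add: diag_in_cylinder_diag[OF zero S(2)])
  qed
  have "k \<notin> Per (Lcm S) ?x"
  proof
    assume per: "k \<in> Per (Lcm S) ?x"
    have same: "m \<in> E_set B \<longleftrightarrow> k \<in> E_set B" if "diag B m \<in> cylinder B S h" for m
      using that unfolding diag_cyl by (rule Per_indicatorD[OF per])
    show False
    proof (cases "k \<in> E_set B")
      case True
      have "cylinder B S h \<subseteq> window' B"
      proof
        fix g assume g: "g \<in> cylinder B S h"
        have "H_top B interior_of window B \<inter> cylinder B T g \<noteq> {}" if T: "finite T \<and> T \<subseteq> B" for T
        proof -
          obtain m where m: "diag B m \<in> cylinder B (S \<union> T) g"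
            using diag_dense[OF zero, of g "S \<union> T"] g S T by (auto simp: in_cylinder)
          then have "diag B m \<in> cylinder B S h" using g by (simp add: in_cylinder)
          then have "m \<in> E_set B" using same True by simp
          then have "diag B m \<in> H_top B interior_of window B"
            using diag_in_interior_window_iff[OF zero] by simp
          moreover have "diag B m \<in> cylinder B T g" using m cylinder_mono[of T "S \<union> T"] by blast
          ultimately show ?thesis by blast
        qed
        then show "g \<in> window' B"
          using g unfolding window'_def closure_of_H_top_iff[OF zero] by (simp add: in_cylinder)
      qed
      then have "h \<in> H_top B interior_of window' B"
        using H S by (auto simp: interior_of_H_top_iff[OF zero])
      then show False using not_int by simp
    next
      case False
      have "h \<in> window' B" using cl unfolding window'_def by simp
      then obtain g where g: "g \<in> H_top B interior_of window B" "g \<in> cylinder B S h"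
        using S unfolding window'_def closure_of_H_top_iff[OF zero] by blast
      obtain m where m: "diag B m \<in> H_top B interior_of window B" "diag B m \<in> cylinder B S g"
        using open_meets_diag[OF zero openin_interior_of g(1) S] by blast
      have "m \<in> E_set B" using m(1) diag_in_interior_window_iff[OF zero] by simp
      moreover have "diag B m \<in> cylinder B S h" using m(2) g(2) by (simp add: in_cylinder)
      ultimately show False using same False by simp
    qed
  qed
  then show "h \<in> boundary_cover B S" using in_boundary_cover_diag[OF zero S H k] by simp
qed

text \<open>
  If every cylinder around \<open>h\<close> contains diagonal points of both kinds, those with index in \<open>E_set B\<close>
  place \<open>h\<close> in \<open>window' B\<close>, and the others keep it out of the interior of \<open>window' B\<close>. The
  sets \<open>B \<inter> {..n}\<close> are cofinal among the finite subsets of \<open>B\<close>, which turns the intersection into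
  that of a decreasing sequence.
\<close>

lemma frontier_eq_INT_boundary_cover:
  assumes zero: "0 \<notin> B" and "B \<noteq> {}"
  shows "H_top B frontier_of window' B = (\<Inter>n::nat. boundary_cover B (B \<inter> {..n}))"
proof (intro equalityI subsetI)
  fix h assume "h \<in> H_top B frontier_of window' B"
  then have "h \<in> boundary_cover B (B \<inter> {..n})" for n :: nat
    by (intro subsetD[OF frontier_subset_boundary_cover[OF assms]]) auto
  then show "h \<in> (\<Inter>n::nat. boundary_cover B (B \<inter> {..n}))" by simp
next
  let ?x = "indicator (E_set B) :: int \<Rightarrow> nat"
  fix h assume h: "h \<in> (\<Inter>n::nat. boundary_cover B (B \<inter> {..n}))"
  then have "h \<in> boundary_cover B (B \<inter> {..0})" by blast
  then have H: "h \<in> H_set B" by (auto simp: boundary_cover_def in_cylinder)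
  have mixed: "\<exists>m m'. m \<in> E_set B \<and> m' \<notin> E_set B \<and>
      diag B m \<in> cylinder B S h \<and> diag B m' \<in> cylinder B S h" if S: "finite S" "S \<subseteq> B" for S
  proof -
    obtain n where "S \<subseteq> {..n}" using S(1) finite_nat_iff_bounded_le by blast
    then have "boundary_cover B (B \<inter> {..n}) \<subseteq> boundary_cover B S"
      using S by (intro boundary_cover_antimono zero) auto
    then have h': "h \<in> boundary_cover B S" using h by blast
    obtain k where k: "diag B k \<in> cylinder B S h" using diag_dense[OF zero H S] by blast
    then have "k \<notin> Per (Lcm S) ?x" using in_boundary_cover_diag[OF zero S H] h' by blast
    then obtain l where l: "int (Lcm S) dvd l - k" "?x l \<noteq> ?x k" unfolding Per_iff by blast
    have "cylinder B S h = cylinder B S (diag B k)"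
      using k by (intro cylinder_eq) (simp add: in_cylinder)
    then have "diag B l \<in> cylinder B S h" using l(1) by (simp add: diag_in_cylinder_diag[OF zero S(2)])
    moreover have "l \<in> E_set B \<longleftrightarrow> k \<notin> E_set B"
      using l(2) by (cases "l \<in> E_set B"; cases "k \<in> E_set B") auto
    ultimately show ?thesis using k by blast
  qed
  have "h \<in> window' B"
    unfolding window'_def closure_of_H_top_iff[OF zero]
    using H mixed diag_in_interior_window_iff[OF zero] by blast
  moreover have "window' B \<subseteq> H_set B"
    by (auto simp: window'_def closure_of_H_top_iff[OF zero])
  ultimately have "h \<in> H_top B closure_of window' B"
    using closure_of_subset[of "window' B" "H_top B"] by (auto simp: topspace_H_top[OF zero])
  moreover have "h \<notin> H_top B interior_of window' B"
  proof
    assume "h \<in> H_top B interior_of window' B"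
    then obtain S where S: "finite S" "S \<subseteq> B" "cylinder B S h \<subseteq> window' B"
      unfolding interior_of_H_top_iff[OF zero] by blast
    then obtain m where "m \<notin> E_set B" "diag B m \<in> window' B" using mixed by blast
    then show False using diag_in_window'_iff[OF assms] by simp
  qed
  ultimately show "h \<in> H_top B frontier_of window' B" by (simp add: frontier_of_def)
qed

section \<open>Haar measure of the frontier\<close>

lemma mult_H_grp: "h \<otimes>\<^bsub>H_grp B\<^esub> g = (\<lambda>b\<in>B. (h b + g b) mod int b)"
  by (simp add: H_grp_def prod_grp_def)

lemma diag_mult_diag: "diag B m \<otimes>\<^bsub>H_grp B\<^esub> diag B n = diag B (m + n)"
  by (auto simp: mult_H_grp diag_def mod_add_eq)

lemma diag_mult_in_H_set:
  assumes zero: "0 \<notin> B" and h: "h \<in> H_set B"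
  shows "diag B k \<otimes>\<^bsub>H_grp B\<^esub> h \<in> H_set B"
  unfolding H_set_iff[OF zero]
proof (intro conjI allI impI)
  show "diag B k \<otimes>\<^bsub>H_grp B\<^esub> h \<in> residue_families B"
    using base_pos[OF zero] by (auto simp: mult_H_grp residue_families_def PiE_iff)
  fix S assume S: "finite S \<and> S \<subseteq> B"
  then obtain n where "\<forall>b\<in>S. h b = n mod int b" using h unfolding H_set_iff[OF zero] by blast
  then have "\<forall>b\<in>S. (diag B k \<otimes>\<^bsub>H_grp B\<^esub> h) b = (k + n) mod int b"
    using S by (auto simp: mult_H_grp diag_apply mod_add_eq)
  then show "\<exists>n. \<forall>b\<in>S. (diag B k \<otimes>\<^bsub>H_grp B\<^esub> h) b = n mod int b" by blast
qed

lemma translate_cylinder: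
  assumes zero: "0 \<notin> B" and "S \<subseteq> B"
  shows "(\<lambda>h. diag B k \<otimes>\<^bsub>H_grp B\<^esub> h) ` cylinder B S (diag B 0) = cylinder B S (diag B k)"
proof (intro equalityI subsetI)
  fix g assume "g \<in> (\<lambda>h. diag B k \<otimes>\<^bsub>H_grp B\<^esub> h) ` cylinder B S (diag B 0)"
  then obtain h where h: "h \<in> cylinder B S (diag B 0)" "g = diag B k \<otimes>\<^bsub>H_grp B\<^esub> h" by blast
  have "g b = diag B k b" if "b \<in> S" for b
  proof -
    have "b \<in> B" using that \<open>S \<subseteq> B\<close> by blast
    moreover have "h b = 0" using h(1) that \<open>b \<in> B\<close> by (simp add: in_cylinder diag_apply)
    ultimately show ?thesis by (simp add: h(2) mult_H_grp diag_apply)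
  qed
  then show "g \<in> cylinder B S (diag B k)"
    using h diag_mult_in_H_set[OF zero] by (simp add: in_cylinder)
next
  fix g assume g: "g \<in> cylinder B S (diag B k)"
  \<comment> \<open>Translating by \<open>diag B (- k)\<close> undoes the translation by \<open>diag B k\<close>.\<close>
  define h where "h = diag B (- k) \<otimes>\<^bsub>H_grp B\<^esub> g"
  have H: "g \<in> H_set B" using g by (simp add: in_cylinder)
  have "h b = diag B 0 b" if "b \<in> S" for b
  proof -
    have "b \<in> B" using that \<open>S \<subseteq> B\<close> by blast
    moreover have "g b = k mod int b" using g that \<open>b \<in> B\<close> by (simp add: in_cylinder diag_apply)
    ultimately show ?thesis by (simp add: h_def mult_H_grp diag_apply mod_add_eq)
  qed
  then have "h \<in> cylinder B S (diag B 0)"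
    using diag_mult_in_H_set[OF zero H] by (simp add: in_cylinder h_def)
  moreover have "g = diag B k \<otimes>\<^bsub>H_grp B\<^esub> h"
  proof
    fix b show "g b = (diag B k \<otimes>\<^bsub>H_grp B\<^esub> h) b"
    proof (cases "b \<in> B")
      case True
      have "(k mod int b + ((- k) mod int b + g b) mod int b) mod int b = (k + ((- k) + g b)) mod int b"
        by (metis mod_add_left_eq mod_add_right_eq)
      then show ?thesis
        using True H_set_residue[OF zero H True] by (simp add: h_def mult_H_grp diag_apply)
    next
      case False
      have "g \<in> Pi\<^sub>E B (\<lambda>b. {0..<int b})"
        using H unfolding H_set_iff[OF zero] residue_families_def by (rule conjunct1)
      then have "g b = undefined" using False by (rule PiE_arb)
      then show ?thesis using False by (simp add: mult_H_grp)
    qed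
  qed
  ultimately show "g \<in> (\<lambda>h. diag B k \<otimes>\<^bsub>H_grp B\<^esub> h) ` cylinder B S (diag B 0)" by blast
qed

context
  fixes B :: "nat set" and m :: "(nat \<Rightarrow> int) measure"
  assumes zero: "0 \<notin> B" and haar: "normalised_haar_measure (H_grp B) (H_top B) m"
begin

lemma haar_prob_space: "prob_space m"
  using haar by (simp add: normalised_haar_measure_def)

lemma cylinder_measurable: "cylinder B S h \<in> sets m" if "finite S" "S \<subseteq> B"
  using haar openin_cylinder[OF zero that]
  by (auto simp: normalised_haar_measure_def intro: sigma_sets.Basic)

text \<open>
  Invariance gives the cylinders over \<open>S\<close> the same measure, and they are disjoint for distinct
  representatives \<open>k\<close> modulo \<open>Lcm S\<close>.
\<close>

lemma measure_Union_cylinders: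
  assumes S: "finite S" "S \<subseteq> B" and K: "K \<subseteq> {0..<int (Lcm S)}"
  shows "measure m (\<Union>k\<in>K. cylinder B S (diag B k)) =
    real (card K) * measure m (cylinder B S (diag B 0))"
proof -
  interpret prob_space m by (rule haar_prob_space)
  have translate: "measure m (cylinder B S (diag B k)) = measure m (cylinder B S (diag B 0))" for k
  proof -
    have "diag B k \<in> carrier (H_grp B)" using diag_in_H_set[OF zero] by (simp add: H_grp_def)
    then have "emeasure m ((\<lambda>h. diag B k \<otimes>\<^bsub>H_grp B\<^esub> h) ` cylinder B S (diag B 0)) =
        emeasure m (cylinder B S (diag B 0))"
      using haar cylinder_measurable[OF S] by (simp add: normalised_haar_measure_def)
    then show ?thesis by (simp add: translate_cylinder[OF zero S(2)] measure_def)
  qed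
  have "finite K" using K by (rule finite_subset) simp
  moreover have "disjoint_family_on (\<lambda>k. cylinder B S (diag B k)) K"
    unfolding disjoint_family_on_def
  proof (intro ballI impI)
    fix k l assume kl: "k \<in> K" "l \<in> K" "k \<noteq> l"
    have "\<not> int (Lcm S) dvd k - l"
    proof
      assume "int (Lcm S) dvd k - l"
      then have "k mod int (Lcm S) = l mod int (Lcm S)" by (simp add: mod_eq_dvd_iff)
      moreover have "k mod int (Lcm S) = k" "l mod int (Lcm S) = l"
        using kl K by (auto intro!: mod_pos_pos_trivial)
      ultimately show False using kl(3) by simp
    qed
    then have *: "diag B k \<notin> cylinder B S (diag B l)" using diag_in_cylinder_diag[OF zero S(2)] by simp
    show "cylinder B S (diag B k) \<inter> cylinder B S (diag B l) = {}"
    proof (rule ccontr)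
      assume "cylinder B S (diag B k) \<inter> cylinder B S (diag B l) \<noteq> {}"
      then obtain g where "g \<in> cylinder B S (diag B k)" "g \<in> cylinder B S (diag B l)" by blast
      then have "diag B k \<in> cylinder B S (diag B l)"
        by (auto simp: in_cylinder diag_in_H_set[OF zero])
      then show False using * by simp
    qed
  qed
  ultimately have "measure m (\<Union>k\<in>K. cylinder B S (diag B k)) =
      (\<Sum>k\<in>K. measure m (cylinder B S (diag B k)))"
    using cylinder_measurable[OF S] by (intro finite_measure_finite_Union) auto
  also have "\<dots> = (\<Sum>k\<in>K. measure m (cylinder B S (diag B 0)))"
    by (intro sum.cong refl translate)
  finally show ?thesis by simp
qed

lemma measure_cylinder:
  assumes S: "finite S" "S \<subseteq> B"
  shows "measure m (cylinder B S (diag B 0)) = 1 / real (Lcm S)"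
proof -
  interpret prob_space m by (rule haar_prob_space)
  have L: "Lcm S \<ge> 1" using S zero by (intro Lcm_pos) auto
  have "space m = H_set B"
    using haar by (simp add: normalised_haar_measure_def topspace_H_top[OF zero])
  also have "\<dots> = (\<Union>k\<in>{0..<int (Lcm S)}. cylinder B S (diag B k))"
  proof (intro equalityI subsetI)
    fix h assume h: "h \<in> H_set B"
    obtain k where k: "diag B k \<in> cylinder B S h" using diag_dense[OF zero h S] by blast
    define l where "l = k mod int (Lcm S)"
    have "diag B k \<in> cylinder B S (diag B l)"
      by (simp add: diag_in_cylinder_diag[OF zero S(2)] l_def)
    then have "h \<in> cylinder B S (diag B l)" using k h by (simp add: in_cylinder)
    moreover have "l \<in> {0..<int (Lcm S)}" using L by (simp add: l_def)
    ultimately show "h \<in> (\<Union>k\<in>{0..<int (Lcm S)}. cylinder B S (diag B k))" by blast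
  qed (auto simp: in_cylinder)
  finally have "real (card {0..<int (Lcm S)}) * measure m (cylinder B S (diag B 0)) = 1"
    using measure_Union_cylinders[OF S order_refl] prob_space by simp
  then show ?thesis using L by (simp add: field_simps)
qed

lemma measure_boundary_cover:
  assumes S: "finite S" "S \<subseteq> B"
  shows "boundary_cover B S \<in> sets m"
    and "measure m (boundary_cover B S) =
      1 - density (Per (Lcm S) (indicator (E_set B) :: int \<Rightarrow> nat))"
proof -
  let ?P = "Per (Lcm S) (indicator (E_set B) :: int \<Rightarrow> nat)" and ?I = "{0..<int (Lcm S)}"
  show "boundary_cover B S \<in> sets m"
    unfolding boundary_cover_def using cylinder_measurable[OF S] by (intro sets.finite_UN) auto
  have L: "Lcm S \<ge> 1" using S zero by (intro Lcm_pos) auto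
  have "card (?I - ?P) = card ?I - card (?P \<inter> ?I)"
    by (subst card_Diff_subset_Int) (auto simp: Int_commute)
  moreover have "card (?P \<inter> ?I) \<le> card ?I" by (intro card_mono) auto
  ultimately have "real (card (?I - ?P)) = real (Lcm S) - real (card (?P \<inter> ?I))"
    by (simp add: of_nat_diff)
  moreover have "measure m (boundary_cover B S) = real (card (?I - ?P)) * (1 / real (Lcm S))"
    unfolding boundary_cover_def measure_cylinder[OF S, symmetric]
    by (intro measure_Union_cylinders S) auto
  ultimately show "measure m (boundary_cover B S) = 1 - density ?P"
    using L by (simp add: density_Per diff_divide_distrib)
qed

text \<open>
  A bound for all periods \<open>p\<close>, obtained by passing to a larger set \<open>Per (Lcm S)\<close>.
\<close>

lemma density_Per_le_1_minus_frontier: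
  assumes "B \<noteq> {}" "p \<ge> 1"
  shows "density (Per p (indicator (E_set B) :: int \<Rightarrow> nat)) \<le>
    1 - measure m (H_top B frontier_of window' B)"
proof -
  interpret prob_space m by (rule haar_prob_space)
  let ?x = "indicator (E_set B) :: int \<Rightarrow> nat"
  obtain S where S: "finite S" "S \<subseteq> B" "Per p ?x \<subseteq> Per (Lcm S) ?x"
    using exists_Lcm_Per_superset[OF E_set_local_period[OF zero assms(1)] assms(2)] by metis
  have "Lcm S \<ge> 1" using S zero by (intro Lcm_pos) auto
  then have "density (Per p ?x) \<le> density (Per (Lcm S) ?x)"
    using S(3) assms(2) by (intro density_Per_mono)
  moreover have "measure m (H_top B frontier_of window' B) \<le> measure m (boundary_cover B S)"
    using measure_boundary_cover(1)[OF S(1,2)] frontier_subset_boundary_cover[OF zero assms(1) S(1,2)]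
    by (intro finite_measure_mono)
  ultimately show ?thesis using measure_boundary_cover(2)[OF S(1,2)] by simp
qed

lemma density_Per_tendsto:
  assumes "B \<noteq> {}"
  shows "(\<lambda>n. density (Per (Lcm (B \<inter> {..n})) (indicator (E_set B) :: int \<Rightarrow> nat)))
    \<longlonglongrightarrow> 1 - measure m (H_top B frontier_of window' B)"
proof -
  interpret prob_space m by (rule haar_prob_space)
  have fin: "finite (B \<inter> {..n})" "B \<inter> {..n} \<subseteq> B" for n :: nat by auto
  have "decseq (\<lambda>n. boundary_cover B (B \<inter> {..n}))"
    unfolding decseq_def by (intro allI impI boundary_cover_antimono[OF zero fin]) auto
  then have "(\<lambda>n. measure m (boundary_cover B (B \<inter> {..n})))
      \<longlonglongrightarrow> measure m (\<Inter>n. boundary_cover B (B \<inter> {..n}))"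
    using measure_boundary_cover(1)[OF fin] by (intro finite_Lim_measure_decseq) auto
  then have "(\<lambda>n. 1 - measure m (boundary_cover B (B \<inter> {..n})))
      \<longlonglongrightarrow> 1 - measure m (H_top B frontier_of window' B)"
    unfolding frontier_eq_INT_boundary_cover[OF zero assms] by (intro tendsto_intros)
  then show ?thesis by (simp add: measure_boundary_cover(2)[OF fin])
qed

text \<open>
  The periods \<open>Lcm (B \<inter> {..n})\<close> attain the upper bound in the limit.
\<close>

lemma SUP_density_Per:
  assumes "B \<noteq> {}"
  shows "(SUP p\<in>{1..}. density (Per p (indicator (E_set B) :: int \<Rightarrow> nat))) =
    1 - measure m (H_top B frontier_of window' B)"
proof (rule antisym)
  let ?x = "indicator (E_set B) :: int \<Rightarrow> nat"
  show "(SUP p\<in>{1..}. density (Per p ?x)) \<le> 1 - measure m (H_top B frontier_of window' B)"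
    using density_Per_le_1_minus_frontier[OF assms] by (intro cSUP_least) auto
  have "bdd_above ((\<lambda>p. density (Per p ?x)) ` {1..})"
    using density_Per_le_1 by (intro bdd_aboveI[of _ 1]) auto
  then have "density (Per (Lcm (B \<inter> {..n})) ?x) \<le> (SUP p\<in>{1..}. density (Per p ?x))" for n :: nat
    using zero Lcm_pos[of "B \<inter> {..n}"] by (intro cSUP_upper) auto
  then show "1 - measure m (H_top B frontier_of window' B) \<le> (SUP p\<in>{1..}. density (Per p ?x))"
    by (intro LIMSEQ_le_const2[OF density_Per_tendsto[OF assms]]) auto
qed

end

theorem proposition1:
  fixes B :: "nat set" and m_H :: "(nat \<Rightarrow> int) measure"
  assumes "0 \<notin> B" and "B \<noteq> {}" and "primitive_set B"
    and "normalised_haar_measure (H_grp B) (H_top B) m_H"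
  shows "(indicator (free_ints (B_star B)) :: int \<Rightarrow> nat) = coding B (window' B) (diag B 0)
    \<and> coding B (window' B) (diag B 0) = indicator (E_set B)
    \<and> toeplitz (indicator (free_ints (B_star B)) :: int \<Rightarrow> nat)
    \<and> (regular_toeplitz (indicator (free_ints (B_star B)) :: int \<Rightarrow> nat)
        \<longleftrightarrow> measure m_H (H_top B frontier_of window' B) = 0)"
proof -
  have coding: "coding B (window' B) (diag B 0) = indicator (E_set B)"
    by (auto simp: coding_def diag_mult_diag diag_in_window'_iff[OF assms(1,2)] indicator_def)
  have toeplitz: "toeplitz (indicator (E_set B) :: int \<Rightarrow> nat)"
    unfolding toeplitz_def
  proof
    fix n
    obtain S where S: "finite S" "S \<subseteq> B" "n \<in> Per (Lcm S) (indicator (E_set B) :: int \<Rightarrow> nat)"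
      using E_set_local_period[OF assms(1,2)] by blast
    have "Lcm S \<ge> 1" using S assms(1) by (intro Lcm_pos) auto
    then show "\<exists>p::nat. p \<ge> 1 \<and>
        (\<forall>k::int. indicator (E_set B) (n + k * int p) = (indicator (E_set B) n :: nat))"
      using S(3) unfolding Per_def by blast
  qed
  show ?thesis
    using coding toeplitz SUP_density_Per[OF assms(1,4,2)]
    by (simp add: free_ints_B_star[OF assms(1,2)] regular_toeplitz_def)
qed

end
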